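(* Let $L:=\operatorname{arsinh}1=\log(1+\sqrt2)$ and $\rho:=\sqrt2-1=e^{-L}$. Then $$\sum_{r=0}^{\infty}\frac{\binom{4r}{2r}}{16^r(4r+1)^2}=\frac\pi4\log2+\frac L2\log2-\frac{L^2}4+\frac{\pi^2}{24}-\frac14\operatorname{Li}_2(\rho^2),$$ and $$\sum_{r=1}^{\infty}\frac{16^r}{r^3\binom{4r}{2r}}=4\pi^2\log2+\frac{32}3L^3-16L^2\log2+16L\operatorname{Li}_2(\rho^2)+8\operatorname{Li}_3(\rho^2)-22\zeta(3).$$
   Context: $\operatorname{Li}_k(x)=\sum_{n\ge1}x^n/n^k$ is the polylogarithm (here $0<\rho^2<1$, real principal branch) and $\zeta$ is the Riemann zeta function. *)

theory Defs
  imports "HOL-Analysis.Analysis"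
begin

(* Only meaningful for \<bar>x\<bar> < 1 (see polylog_sums), where the series is the real principal
   branch. The sum is shifted to start at index 0. *)
definition polylog :: "nat \<Rightarrow> real \<Rightarrow> real" where
  "polylog k x = (\<Sum>n. x ^ Suc n / real (Suc n) ^ k)"

(* The Dirichlet series of the Riemann zeta function on the real half-line s > 1, where it
   converges (see zeta_sums); no analytic continuation is intended for s \<le> 1. *)
definition zeta :: "real \<Rightarrow> real" where
  "zeta s = (\<Sum>n. real (Suc n) powr (- s))"

lemma polylog_sums:
  assumes "\<bar>x\<bar> < 1"
  shows "(\<lambda>n. x ^ Suc n / real (Suc n) ^ k) sums polylog k x"
proof -
  have "summable (\<lambda>n. x ^ Suc n / real (Suc n) ^ k)"
  proof (rule summable_comparison_test')
    show "summable (\<lambda>n. \<bar>x\<bar> ^ Suc n)"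
      using assms summable_geometric[of "\<bar>x\<bar>"] by (subst summable_Suc_iff) simp
    fix n :: nat
    have "1 \<le> real (Suc n) ^ k"
      by (rule one_le_power) simp
    then have "\<bar>x\<bar> ^ Suc n / real (Suc n) ^ k \<le> \<bar>x\<bar> ^ Suc n / 1"
      by (intro divide_left_mono) auto
    then show "norm (x ^ Suc n / real (Suc n) ^ k) \<le> \<bar>x\<bar> ^ Suc n"
      by (simp only: real_norm_def abs_divide power_abs abs_of_nat div_by_1)
  qed
  then show ?thesis
    unfolding polylog_def by (rule summable_sums)
qed

lemma zeta_sums:
  assumes "s > 1"
  shows "(\<lambda>n. real (Suc n) powr (- s)) sums zeta s"
proof -
  have "summable (\<lambda>n. real n powr (- s))"
    using assms by (simp add: summable_real_powr_iff)
  then have "summable (\<lambda>n. real (Suc n) powr (- s))"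
    by (subst summable_Suc_iff)
  then show ?thesis
    unfolding zeta_def by (rule summable_sums)
qed

lemma arsinh_1_eq: "arsinh (1::real) = ln (1 + sqrt 2)"
  by (simp add: arsinh_real_def)

lemma sqrt2_minus_1_eq: "sqrt 2 - 1 = exp (- arsinh (1::real))"
proof -
  have "(sqrt 2 - 1) * (1 + sqrt 2) = 1"
    by (simp add: algebra_simps)
  moreover have "1 + sqrt 2 > (0::real)"
    by (simp add: add_pos_pos)
  ultimately show ?thesis
    by (simp add: arsinh_1_eq exp_minus field_simps)
qed

end

theory Submission
  imports Defs "HOL-Real_Asymp.Real_Asymp"
begin

text \<open>
  Both sums are the even-indexed halves of power series evaluated on the unit circle. Let
  \<open>F\<close> be the series of the antiderivative of \<open>arsinh x / x\<close> (respectively of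
  \<open>arsinh\<^sup>2 x / x\<close>). The substitution \<open>x = sinh w\<close> turns its derivative into
  \<open>w coth w\<close> (respectively \<open>w\<^sup>2 coth w\<close>), which for \<open>Re w > 0\<close> also has an antiderivative
  \<open>P\<close> in terms of \<open>Ln (1 - e)\<close>, \<open>Li\<^sub>2 e\<close> and \<open>Li\<^sub>3 e\<close> with \<open>e = exp (-2w)\<close>. Hence
  \<open>F (sinh w) - P w\<close> is constant on \<open>{w. 0 < Re w, \<bar>Im w\<bar> < \<pi>/2, \<bar>sinh w\<bar> < 1}\<close>. The constant is
  found by letting \<open>w \<rightarrow> 0\<close>, and since all series converge absolutely on the closed unit disc the
  identity extends to \<open>w = arsinh 1\<close> and \<open>w = \<i>\<pi>/2\<close>, where \<open>sinh w\<close> is \<open>1\<close> and \<open>\<i>\<close>. The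
  even-indexed terms are half the sum of the resulting alternating and non-alternating series.
\<close>

subsection \<open>Power series on the closed unit disc\<close>

lemma fps_conv_radius_ge_1:
  fixes F :: "complex fps"
  assumes "summable (\<lambda>n. norm (fps_nth F n))"
  shows "1 \<le> fps_conv_radius F"
proof -
  have "summable (\<lambda>n. fps_nth F n * 1 ^ n)"
    using summable_norm_cancel[OF assms] by simp
  from conv_radius_geI[OF this] show ?thesis
    by (simp add: fps_conv_radius_def one_ereal_def)
qed

lemma sums_eval_fps_cball:
  fixes F :: "complex fps"
  assumes "summable (\<lambda>n. norm (fps_nth F n))" and "norm z \<le> 1"
  shows "(\<lambda>n. fps_nth F n * z ^ n) sums eval_fps F z"
  unfolding eval_fps_def
proof (intro summable_sums summable_comparison_test'[OF assms(1)])
  fix n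
  show "norm (fps_nth F n * z ^ n) \<le> norm (fps_nth F n)"
    using assms(2) by (simp add: norm_mult norm_power mult_left_le power_le_one)
qed

text \<open>The Weierstrass M-test bounds every term by its coefficient. Continuity up to the unit
  circle is what allows passing to the boundary values \<open>sinh w = 1\<close> and
  \<open>sinh w = \<i>\<close>.\<close>

lemma continuous_on_eval_fps_cball:
  fixes F :: "complex fps"
  assumes "summable (\<lambda>n. norm (fps_nth F n))"
  shows "continuous_on (cball 0 1) (eval_fps F)"
proof (rule uniform_limit_theorem)
  show "uniform_limit (cball 0 1) (\<lambda>n z. \<Sum>i<n. fps_nth F i * z ^ i) (eval_fps F) sequentially"
    unfolding eval_fps_def
  proof (rule Weierstrass_m_test[OF _ assms])
    fix n and z :: complex
    assume "z \<in> cball 0 1"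
    then show "norm (fps_nth F n * z ^ n) \<le> norm (fps_nth F n)"
      by (simp add: norm_mult norm_power mult_left_le power_le_one)
  qed
qed (auto intro!: always_eventually continuous_intros)

lemma has_field_derivative_eval_fps_compose:
  fixes F :: "complex fps"
  assumes "1 \<le> fps_conv_radius F" and "norm (g z) < 1" and "(g has_field_derivative D) (at z)"
  shows "((\<lambda>z. eval_fps F (g z)) has_field_derivative eval_fps (fps_deriv F) (g z) * D) (at z)"
proof (rule DERIV_chain2[OF has_field_derivative_eval_fps assms(3)])
  have "ereal (norm (g z)) < 1"
    using assms(2) by (simp add: one_ereal_def)
  then show "ereal (norm (g z)) < fps_conv_radius F"
    using assms(1) by (rule less_le_trans)
qed

subsection \<open>The substitution \<open>x = sinh w\<close>\<close>

text \<open>The bound on \<open>Im w\<close> selects the component around \<open>0\<close> of the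
  preimage of the open unit disc under \<open>sinh\<close>; the other components are its translates
  by multiples of \<open>\<i> * pi\<close>.\<close>

definition sinh_region :: "complex set" where
  "sinh_region = {w. \<bar>Im w\<bar> < pi / 2 \<and> norm (sinh w) < 1}"

lemma norm_sinh_squared:
  "norm (sinh w) ^ 2 = sinh (Re w) ^ 2 + sin (Im w) ^ 2"
proof -
  have "Re (sinh w) = sinh (Re w) * cos (Im w)" "Im (sinh w) = cosh (Re w) * sin (Im w)"
    by (simp_all add: sinh_field_def cosh_field_def Re_exp Im_exp algebra_simps)
  then have "norm (sinh w) ^ 2 = sinh (Re w) ^ 2 * cos (Im w) ^ 2 + cosh (Re w) ^ 2 * sin (Im w) ^ 2"
    by (simp add: cmod_power2 power_mult_distrib)
  also have "\<dots> = sinh (Re w) ^ 2 + sin (Im w) ^ 2"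
    by (simp add: cosh_square_eq cos_squared_eq algebra_simps)
  finally show ?thesis .
qed

text \<open>By the formula for the norm, the condition is
  \<open>sinh (Re w) ^ 2 < cos (Im w) ^ 2\<close>, and the cosine is positive here. This gives the
  half-width of each horizontal slice of the region.\<close>

lemma norm_sinh_less_1_iff:
  assumes "\<bar>Im w\<bar> < pi / 2"
  shows "norm (sinh w) < 1 \<longleftrightarrow> \<bar>Re w\<bar> < arsinh (cos (Im w))"
proof -
  have c: "cos (Im w) > 0"
    using assms by (intro cos_gt_zero_pi) auto
  have "norm (sinh w) < 1 \<longleftrightarrow> norm (sinh w) ^ 2 < 1"
    by (simp add: abs_square_less_1)
  also have "\<dots> \<longleftrightarrow> sinh (Re w) ^ 2 < cos (Im w) ^ 2"
    by (simp add: norm_sinh_squared cos_squared_eq) linarith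
  also have "\<dots> \<longleftrightarrow> \<bar>sinh (Re w)\<bar> < cos (Im w)"
    using c abs_le_square_iff[of "cos (Im w)" "sinh (Re w)"] by (simp flip: not_le)
  also have "\<dots> \<longleftrightarrow> sinh \<bar>Re w\<bar> < sinh (arsinh (cos (Im w)))"
    by simp
  also have "\<dots> \<longleftrightarrow> \<bar>Re w\<bar> < arsinh (cos (Im w))"
    by (simp only: sinh_real_less_iff)
  finally show ?thesis .
qed


lemma open_sinh_region: "open sinh_region"
  unfolding sinh_region_def by (intro open_Collect_conj open_Collect_less continuous_intros)

lemma arsinh_cos_pos:
  fixes t :: real
  assumes "\<bar>t\<bar> < pi / 2"
  shows "0 < arsinh (cos t)"
  using assms by (simp add: cos_gt_zero_pi)

text \<open>Parametrising the region by a rectangle gives its connectedness.\<close>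

lemma sinh_region_image:
  assumes I: "I = {-1<..<1} \<and> S = UNIV \<or> I = {0<..<1} \<and> S = {0<..}"
  shows "{w \<in> sinh_region. Re w \<in> S} =
    (\<lambda>p. Complex (fst p * arsinh (cos (snd p))) (snd p)) ` (I \<times> {-(pi / 2)<..<pi / 2})"
proof (intro equalityI subsetI)
  fix w assume "w \<in> {w \<in> sinh_region. Re w \<in> S}"
  then have t: "\<bar>Im w\<bar> < pi / 2" and r: "\<bar>Re w\<bar> < arsinh (cos (Im w))" and S: "Re w \<in> S"
    using norm_sinh_less_1_iff by (auto simp: sinh_region_def)
  \<comment> \<open>\<open>l\<close> is the position of \<open>Re w\<close> relative to the
    half-width of its slice. The half-width is positive, so \<open>l\<close> has the sign of
    \<open>Re w\<close>, which settles both choices of \<open>S\<close>.\<close>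
  define l where "l = Re w / arsinh (cos (Im w))"
  have "l \<in> I" "Re w = l * arsinh (cos (Im w))"
    using I r S arsinh_cos_pos[OF t] by (auto simp: l_def field_simps)
  then show "w \<in> (\<lambda>p. Complex (fst p * arsinh (cos (snd p))) (snd p)) ` (I \<times> {-(pi / 2)<..<pi / 2})"
    using t by (intro image_eqI[of _ _ "(l, Im w)"]) (auto simp: complex_eq_iff)
next
  fix w assume "w \<in> (\<lambda>p. Complex (fst p * arsinh (cos (snd p))) (snd p)) ` (I \<times> {-(pi / 2)<..<pi / 2})"
  then obtain l t where l: "l \<in> I" and t: "\<bar>t\<bar> < pi / 2"
    and w: "w = Complex (l * arsinh (cos t)) t"
    by auto
  have "\<bar>l\<bar> < 1" using I l by auto
  then have "\<bar>l * arsinh (cos t)\<bar> < arsinh (cos t)"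
    using arsinh_cos_pos[OF t] by (metis abs_mult abs_of_pos mult_strict_right_mono mult_1)
  then show "w \<in> {w \<in> sinh_region. Re w \<in> S}"
    using norm_sinh_less_1_iff[of w] arsinh_cos_pos[OF t] t w I l by (auto simp: sinh_region_def)
qed

text \<open>The set \<open>A\<close> is arbitrary because the closed rectangle is needed as well as
  the open one, in order to reach boundary points.\<close>

lemma continuous_on_region_parametrization:
  "continuous_on A (\<lambda>p :: real \<times> real. Complex (fst p * arsinh (cos (snd p))) (snd p))"
proof -
  have "continuous_on A (\<lambda>p :: real \<times> real. arsinh (cos (snd p)))"
    by (rule continuous_on_compose2[OF continuous_on_arsinh[of UNIV]])
      (auto intro!: continuous_on_cos continuous_on_snd continuous_on_id)
  then show ?thesis
    unfolding Complex_eq by (intro continuous_on_add continuous_on_mult continuous_on_of_real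
        continuous_on_const continuous_on_fst continuous_on_snd continuous_on_id)
qed

lemma connected_sinh_region_image:
  fixes I :: "real set"
  assumes "connected I"
  shows "connected ((\<lambda>p. Complex (fst p * arsinh (cos (snd p))) (snd p)) ` (I \<times> {-(pi / 2)<..<pi / 2}))"
proof (intro connected_continuous_image connected_Times assms)
  show "continuous_on (I \<times> {- (pi / 2)<..<pi / 2}) (\<lambda>p. Complex (fst p * arsinh (cos (snd p))) (snd p))"
    by (rule continuous_on_region_parametrization)
qed simp

lemma connected_sinh_region: "connected sinh_region"
  using connected_sinh_region_image[of "{-1<..<1}"] sinh_region_image[of "{-1<..<1}" UNIV] by simp

lemma connected_right_sinh_region: "connected {w \<in> sinh_region. 0 < Re w}"
  using connected_sinh_region_image[of "{0<..<1}"] sinh_region_image[of "{0<..<1}" "{0<..}"]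
  by simp

text \<open>
  The differential equation is \<open>(1 + x\<^sup>2) f'' + x f' = c\<close>, which in the variable \<open>w\<close> with
  \<open>x = sinh w\<close> becomes \<open>y'' = c\<close>.
\<close>

lemma eval_fps_sinh_quadratic:
  fixes f :: "complex fps"
  assumes R: "1 \<le> fps_conv_radius f"
    and ode: "(1 + fps_X ^ 2) * fps_deriv (fps_deriv f) + fps_X * fps_deriv f = fps_const c"
    and w: "w \<in> sinh_region"
  shows "eval_fps f (sinh w) = fps_nth f 0 + fps_nth f 1 * w + c * w ^ 2 / 2"
proof -
  define f1 where "f1 = fps_deriv f"
  define f2 where "f2 = fps_deriv f1"
  have R1: "1 \<le> fps_conv_radius f1"
    unfolding f1_def using R fps_conv_radius_deriv order_trans by blast
  have R2: "1 \<le> fps_conv_radius f2"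
    unfolding f2_def using R1 fps_conv_radius_deriv order_trans by blast
  have small: "ereal (norm (sinh z)) < 1" if "z \<in> sinh_region" for z
    using that by (simp add: sinh_region_def one_ereal_def)
  have Df: "((\<lambda>w. eval_fps f (sinh w)) has_field_derivative eval_fps f1 (sinh z) * cosh z) (at z)"
    if "z \<in> sinh_region" for z
    unfolding f1_def
    by (rule has_field_derivative_eval_fps_compose[OF R])
      (use that in \<open>auto simp: sinh_region_def intro!: derivative_eq_intros\<close>)
  have Df1: "((\<lambda>w. eval_fps f1 (sinh w)) has_field_derivative eval_fps f2 (sinh z) * cosh z) (at z)"
    if "z \<in> sinh_region" for z
    unfolding f2_def
    by (rule has_field_derivative_eval_fps_compose[OF R1])
      (use that in \<open>auto simp: sinh_region_def intro!: derivative_eq_intros\<close>)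
  \<comment> \<open>The identity of formal series becomes one of functions inside the unit disc,
    where all factors converge.\<close>
  have ode': "(1 + x ^ 2) * eval_fps f2 x + x * eval_fps f1 x = c" if "ereal (norm x) < 1" for x
  proof -
    have X2: "fps_conv_radius (1 + fps_X ^ 2 :: complex fps) = \<infinity>"
      using fps_conv_radius_add[of 1 "fps_X ^ 2 :: complex fps"] by simp
    have r1: "ereal (norm x) < fps_conv_radius f1" and r2: "ereal (norm x) < fps_conv_radius f2"
      using less_le_trans[OF that] R1 R2 by blast+
    have "ereal (norm x) < fps_conv_radius ((1 + fps_X ^ 2) * f2)"
      using fps_conv_radius_mult[of "1 + fps_X ^ 2" f2] r2
      by (simp add: X2 less_le_trans)
    moreover have "ereal (norm x) < fps_conv_radius (fps_X * f1)"
      using fps_conv_radius_mult[of fps_X f1] r1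
      by (simp add: less_le_trans)
    ultimately have "eval_fps ((1 + fps_X ^ 2) * f2 + fps_X * f1) x =
        (1 + x ^ 2) * eval_fps f2 x + x * eval_fps f1 x"
      using r1 r2 by (simp add: eval_fps_add eval_fps_mult X2)
    moreover have "(1 + fps_X ^ 2) * f2 + fps_X * f1 = fps_const c"
      using ode by (simp add: f1_def f2_def)
    ultimately show ?thesis by simp
  qed
  have zero: "0 \<in> sinh_region"
    by (simp add: sinh_region_def)
  \<comment> \<open>With \<open>y w = eval_fps f (sinh w)\<close> this is \<open>y' - c * w\<close>,
    whose derivative \<open>y'' - c\<close> vanishes by the differential equation. Its constant
    value is read off at \<open>w = 0\<close>, where \<open>sinh w = 0\<close> and
    \<open>cosh w = 1\<close>.\<close>
  define y1 where "y1 = (\<lambda>w. eval_fps f1 (sinh w) * cosh w - c * w)"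
  have Dy1: "(y1 has_field_derivative 0) (at z)" if "z \<in> sinh_region" for z
  proof -
    have "(y1 has_field_derivative
        (eval_fps f2 (sinh z) * cosh z) * cosh z + sinh z * eval_fps f1 (sinh z) - c) (at z)"
      unfolding y1_def by (auto intro!: derivative_eq_intros Df1 that)
    also have "(eval_fps f2 (sinh z) * cosh z) * cosh z = cosh z ^ 2 * eval_fps f2 (sinh z)"
      by (simp add: power2_eq_square)
    also have "cosh z ^ 2 = 1 + sinh z ^ 2"
      by (simp add: cosh_square_eq)
    also have "(1 + sinh z ^ 2) * eval_fps f2 (sinh z) + sinh z * eval_fps f1 (sinh z) - c = 0"
      using ode'[OF small[OF that]] by simp
    finally show ?thesis .
  qed
  then have "y1 constant_on sinh_region"
    using connected_sinh_region open_sinh_region by (rule has_field_derivative_0_imp_constant_on)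
  then obtain k where k: "\<And>z. z \<in> sinh_region \<Longrightarrow> y1 z = k"
    unfolding constant_on_def by blast
  then have y1: "y1 z = fps_nth f 1" if "z \<in> sinh_region" for z
  proof -
    have "y1 z = y1 0" using that zero by (simp add: k)
    then show ?thesis by (simp add: y1_def f1_def eval_fps_at_0)
  qed
  \<comment> \<open>Second integration, again with the constant taken from
    \<open>w = 0\<close>.\<close>
  define y where "y = (\<lambda>w. eval_fps f (sinh w) - fps_nth f 1 * w - c * w ^ 2 / 2)"
  have Dy: "(y has_field_derivative 0) (at z)" if "z \<in> sinh_region" for z
  proof -
    have "(y has_field_derivative eval_fps f1 (sinh z) * cosh z - fps_nth f 1 - c * z) (at z)"
      unfolding y_def by (auto intro!: derivative_eq_intros Df that)
    then show ?thesis using y1[OF that] by (simp add: y1_def algebra_simps)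
  qed
  then have "y constant_on sinh_region"
    using connected_sinh_region open_sinh_region by (rule has_field_derivative_0_imp_constant_on)
  then obtain k where k: "\<And>z. z \<in> sinh_region \<Longrightarrow> y z = k"
    unfolding constant_on_def by blast
  then have "y w = y 0"
    using w zero by simp
  then show ?thesis
    by (simp add: y_def eval_fps_at_0 algebra_simps)
qed

section \<open>Boundary points and the comparison of two primitives\<close>

abbreviation right_sinh_region :: "complex set" where
  "right_sinh_region \<equiv> {w \<in> sinh_region. 0 < Re w}"

text \<open>A continuous map sends the closure of the open rectangle into the closure of its image.
  The choices \<open>l = 1\<close>, \<open>t = 0\<close> and \<open>l = 0\<close>,
  \<open>t = pi / 2\<close> give the points \<open>arsinh 1\<close> and
  \<open>\<i> * pi / 2\<close>.\<close>

lemma closure_right_sinh_region: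
  assumes "0 \<le> l" "l \<le> 1" "\<bar>t\<bar> \<le> pi / 2"
  shows "Complex (l * arsinh (cos t)) t \<in> closure right_sinh_region"
proof -
  let ?h = "\<lambda>p. Complex (fst p * arsinh (cos (snd p))) (snd p)"
  have "?h ` closure ({0<..<1} \<times> {-(pi / 2)<..<pi / 2}) \<subseteq> closure right_sinh_region"
  proof (rule image_closure_subset)
    show "continuous_on (closure ({0<..<1} \<times> {-(pi / 2)<..<pi / 2})) ?h"
      by (rule continuous_on_region_parametrization)
    show "?h ` ({0<..<1} \<times> {-(pi / 2)<..<pi / 2}) \<subseteq> closure right_sinh_region"
      using sinh_region_image[of "{0<..<1}" "{0<..}"] closure_subset[of right_sinh_region] by simp
  qed simp
  moreover have "(l, t) \<in> closure ({0<..<1} \<times> {-(pi / 2)<..<pi / 2})"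
    using assms pi_gt_zero by (auto simp: closure_Times closure_greaterThanLessThan abs_le_iff)
  ultimately show ?thesis by force
qed

lemma sinh_nonzero_of_Re_pos: "0 < Re w \<Longrightarrow> sinh w \<noteq> 0"
  using norm_sinh_squared[of w] by (auto simp: sum_power2_eq_zero_iff)

lemma exp_minus_2_neq_1:
  assumes "0 < Re w"
  shows "exp (- 2 * w) \<noteq> 1"
proof
  assume "exp (- 2 * w) = 1"
  then have "norm (exp (- 2 * w)) = 1" by simp
  with assms show False by simp
qed

text \<open>Since \<open>f\<close> is \<open>x F'\<close>, the derivative of
  \<open>F (sinh w)\<close> is \<open>f (sinh w) * cosh w / sinh w\<close>, and the differential
  equation makes \<open>f (sinh w)\<close> a quadratic in \<open>w\<close>. So
  \<open>F (sinh w)\<close> and \<open>P w\<close> differ by a constant on the right half of the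
  region; the limit at \<open>0\<close> determines it and continuity carries the identity to
  \<open>a\<close>.\<close>

lemma eval_fps_sinh_primitive:
  fixes F :: "complex fps" and P :: "complex \<Rightarrow> complex"
  assumes summ: "summable (\<lambda>n. norm (fps_nth F n))" and F0: "fps_nth F 0 = 0"
    and f: "f = fps_X * fps_deriv F"
    and ode: "(1 + fps_X ^ 2) * fps_deriv (fps_deriv f) + fps_X * fps_deriv f = fps_const c"
    and dP: "\<And>w. 0 < Re w \<Longrightarrow>
      (P has_field_derivative (fps_nth f 1 * w + c * w ^ 2 / 2) * cosh w / sinh w) (at w)"
    and contP: "continuous_on {w. 0 \<le> Re w \<and> exp (- 2 * w) \<noteq> 1} P"
    and lim: "((\<lambda>x. P (of_real x)) \<longlongrightarrow> P0) (at_right 0)"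
    and a: "a \<in> closure right_sinh_region" "0 \<le> Re a" "exp (- 2 * a) \<noteq> 1" "norm (sinh a) \<le> 1"
  shows "eval_fps F (sinh a) = P a - P0"
proof -
  have R: "1 \<le> fps_conv_radius F" by (rule fps_conv_radius_ge_1[OF summ])
  have R': "1 \<le> fps_conv_radius (fps_deriv F)"
    using R fps_conv_radius_deriv order_trans by blast
  have Rf: "1 \<le> fps_conv_radius f"
    using fps_conv_radius_mult[of fps_X "fps_deriv F"] R' unfolding f by simp
  have f0: "fps_nth f 0 = 0" by (simp add: f)
  define Q where "Q = (\<lambda>w. eval_fps F (sinh w) - P w)"
  have DQ: "(Q has_field_derivative 0) (at w)" if w: "w \<in> right_sinh_region" for w
  proof -
    have small: "ereal (norm (sinh w)) < 1"
      using w by (simp add: sinh_region_def one_ereal_def)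
    have nz: "sinh w \<noteq> 0" using w sinh_nonzero_of_Re_pos by simp
    have "sinh w * eval_fps (fps_deriv F) (sinh w) = eval_fps f (sinh w)"
      unfolding f using less_le_trans[OF small R'] by (subst eval_fps_mult) auto
    also have "\<dots> = fps_nth f 1 * w + c * w ^ 2 / 2"
      using eval_fps_sinh_quadratic[OF Rf ode, of w] w f0 by simp
    finally have "eval_fps (fps_deriv F) (sinh w) = (fps_nth f 1 * w + c * w ^ 2 / 2) / sinh w"
      using nz by (simp add: field_simps)
    moreover have "((\<lambda>w. eval_fps F (sinh w)) has_field_derivative
        eval_fps (fps_deriv F) (sinh w) * cosh w) (at w)"
      by (rule has_field_derivative_eval_fps_compose[OF R])
        (use w in \<open>auto simp: sinh_region_def intro!: derivative_eq_intros\<close>)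
    ultimately have "((\<lambda>w. eval_fps F (sinh w)) has_field_derivative
        (fps_nth f 1 * w + c * w ^ 2 / 2) * cosh w / sinh w) (at w)"
      by simp
    from DERIV_diff[OF this dP[of w]] w show ?thesis
      by (simp add: Q_def)
  qed
  have "open right_sinh_region"
  proof -
    have "right_sinh_region = sinh_region \<inter> {w. 0 < Re w}" by blast
    then show ?thesis
      using open_Int[OF open_sinh_region open_halfspace_Re_gt] by metis
  qed
  then have "Q constant_on right_sinh_region"
    using DQ connected_right_sinh_region by (intro has_field_derivative_0_imp_constant_on)
  then obtain K where K: "\<And>w. w \<in> right_sinh_region \<Longrightarrow> Q w = K"
    unfolding constant_on_def by blast
  have contF: "continuous_on A (\<lambda>w. eval_fps F (sinh w))"
    if "\<And>w. w \<in> A \<Longrightarrow> norm (sinh w) \<le> 1" for A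
    by (rule continuous_on_compose2[OF continuous_on_eval_fps_cball[OF summ]])
      (use that in \<open>auto intro!: continuous_on_sinh continuous_on_id\<close>)
  \<comment> \<open>\<open>P\<close> is only controlled for \<open>Re w > 0\<close> near
    \<open>0\<close>, so the constant is found from a one-sided limit along the reals, where
    \<open>F (sinh x)\<close> tends to \<open>F 0 = 0\<close>.\<close>
  have "((\<lambda>x. Q (of_real x)) \<longlongrightarrow> 0 - P0) (at_right 0)"
  proof -
    have "isCont (eval_fps F) 0"
      using continuous_on_interior[OF continuous_on_eval_fps_cball[OF summ], of 0] by simp
    moreover have "((\<lambda>x::real. sinh (of_real x) :: complex) \<longlongrightarrow> sinh (of_real 0)) (at_right 0)"
      by (intro tendsto_intros)
    ultimately have "((\<lambda>x::real. eval_fps F (sinh (of_real x))) \<longlongrightarrow> eval_fps F 0) (at_right 0)"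
      using isCont_tendsto_compose[where g = "eval_fps F" and l = 0] by simp
    then show ?thesis
      unfolding Q_def by (intro tendsto_diff lim) (simp add: eval_fps_at_0 F0)
  qed
  moreover have "eventually (\<lambda>x. Q (of_real x) = K) (at_right 0)"
  proof -
    \<comment> \<open>The slice of the region on the real axis has half-width
      \<open>arsinh (cos 0) = arsinh 1\<close>.\<close>
    have "eventually (\<lambda>x::real. x \<in> {0<..<arsinh 1}) (at_right 0)"
      by (rule eventually_at_right_real) simp
    then show ?thesis
    proof eventually_elim
      case (elim x)
      then have "of_real x \<in> right_sinh_region"
        using norm_sinh_less_1_iff[of "of_real x"] by (auto simp: sinh_region_def)
      then show ?case by (rule K)
    qed
  qed
  ultimately have "((\<lambda>x::real. K) \<longlongrightarrow> 0 - P0) (at_right 0)"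
    by (rule Lim_transform_eventually)
  then have KP: "K = - P0"
    by (simp add: tendsto_const_iff)
  obtain x where x: "\<And>n. x n \<in> right_sinh_region" "x \<longlonglongrightarrow> a"
    using a(1) unfolding closure_sequential by blast
  \<comment> \<open>\<open>?T\<close> contains \<open>a\<close> and all points of the approximating
    sequence, and \<open>Q\<close> is continuous on it.\<close>
  let ?T = "{w. 0 \<le> Re w \<and> exp (- 2 * w) \<noteq> 1 \<and> norm (sinh w) \<le> 1}"
  have "continuous_on ?T Q"
    unfolding Q_def by (intro continuous_on_diff contF continuous_on_subset[OF contP]) auto
  moreover have "x n \<in> ?T" for n
    using x(1)[of n] exp_minus_2_neq_1[of "x n"] by (auto simp: sinh_region_def)
  ultimately have "(\<lambda>n. Q (x n)) \<longlonglongrightarrow> Q a"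
    using a x(2) by (intro continuous_on_tendsto_compose[of ?T Q]) auto
  then have "Q a = K"
    using K[OF x(1)] by (simp add: tendsto_const_iff)
  then show ?thesis by (simp add: Q_def KP algebra_simps)
qed

subsection \<open>Polylogarithms and primitives of \<open>w coth w\<close> and \<open>w\<^sup>2 coth w\<close>\<close>

text \<open>For \<open>k > 0\<close> the constant coefficient is \<open>1 / 0 = 0\<close>, so this
  is the expansion of the polylogarithm of order \<open>k\<close> without an index shift.\<close>

definition polylog_fps :: "nat \<Rightarrow> complex fps" where
  "polylog_fps k = Abs_fps (\<lambda>n. 1 / of_nat n ^ k)"

lemma summable_polylog_fps:
  assumes "2 \<le> k"
  shows "summable (\<lambda>n. norm (fps_nth (polylog_fps k) n))"
  using inverse_power_summable[OF assms, where 'a = real]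
  by (simp add: polylog_fps_def norm_inverse norm_power divide_inverse)

lemma polylog_fps_Suc:
  assumes "1 \<le> k"
  shows "fps_X * fps_deriv (polylog_fps (Suc k)) = polylog_fps k"
proof (rule fps_ext)
  fix n
  show "fps_nth (fps_X * fps_deriv (polylog_fps (Suc k))) n = fps_nth (polylog_fps k) n"
    using assms by (cases n) (simp_all add: polylog_fps_def field_simps del: of_nat_Suc)
qed

lemma eval_polylog_fps_1:
  assumes "norm z < 1"
  shows "eval_fps (polylog_fps 1) z = - Ln (1 - z)"
proof -
  have "(\<lambda>n. - (- ((- (- z)) ^ n) / of_nat n)) sums - Ln (1 + (- z))"
    by (intro sums_minus Ln_series') (use assms in simp)
  then show ?thesis
    by (simp add: eval_fps_def polylog_fps_def sums_iff)
qed

text \<open>The inner derivative \<open>- 2 * exp (- 2 * w)\<close> supplies the factor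
  \<open>x\<close> in the rule that \<open>x\<close> times the derivative of the polylogarithm of
  order \<open>Suc k\<close> is the one of order \<open>k\<close>.\<close>

lemma has_field_derivative_polylog_exp:
  assumes "1 \<le> k" and w: "0 < Re w"
  shows "((\<lambda>w. eval_fps (polylog_fps (Suc k)) (exp (- 2 * w))) has_field_derivative
    - 2 * eval_fps (polylog_fps k) (exp (- 2 * w))) (at w)"
proof -
  let ?F = "polylog_fps (Suc k)"
  have R: "1 \<le> fps_conv_radius ?F"
    using assms by (intro fps_conv_radius_ge_1 summable_polylog_fps) simp
  have R': "1 \<le> fps_conv_radius (fps_deriv ?F)"
    using R fps_conv_radius_deriv order_trans by blast
  have small: "ereal (norm (exp (- 2 * w))) < 1"
    using w by (simp add: one_ereal_def)
  have "((\<lambda>w. eval_fps ?F (exp (- 2 * w))) has_field_derivative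
      eval_fps (fps_deriv ?F) (exp (- 2 * w)) * (exp (- 2 * w) * (- 2))) (at w)"
    by (rule has_field_derivative_eval_fps_compose[OF R])
      (use w in \<open>auto intro!: derivative_eq_intros\<close>)
  moreover have "exp (- 2 * w) * eval_fps (fps_deriv ?F) (exp (- 2 * w)) =
      eval_fps (polylog_fps k) (exp (- 2 * w))"
    unfolding polylog_fps_Suc[OF assms(1), symmetric]
    using less_le_trans[OF small R'] by (subst eval_fps_mult) auto
  ultimately show ?thesis by (simp add: mult_ac)
qed

lemma continuous_on_polylog_exp:
  assumes "2 \<le> k"
  shows "continuous_on {w. 0 \<le> Re w} (\<lambda>w. eval_fps (polylog_fps k) (exp (- 2 * w)))"
  by (rule continuous_on_compose2[OF continuous_on_eval_fps_cball[OF summable_polylog_fps[OF assms]]])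
    (auto intro!: continuous_intros)

text \<open>A point of the closed unit disc with real part \<open>1\<close> must be \<open>1\<close>
  itself. This keeps the argument of \<open>Ln\<close> off the branch cut even on the line
  \<open>Re w = 0\<close>, which contains \<open>\<i> * pi / 2\<close>.\<close>

lemma Re_one_minus_exp_pos:
  assumes "0 \<le> Re w" "exp (- 2 * w) \<noteq> 1"
  shows "0 < Re (1 - exp (- 2 * w))"
proof -
  let ?e = "exp (- 2 * w)"
  have n: "norm ?e \<le> 1" using assms(1) by simp
  have "Re ?e \<le> 1" using n complex_Re_le_cmod order_trans by blast
  moreover have "Re ?e \<noteq> 1"
  proof
    assume "Re ?e = 1"
    moreover from this have "Im ?e = 0"
      using n cmod_power2[of ?e] power_le_one[OF norm_ge_zero n, of 2] by simp
    ultimately show False using assms(2) by (simp add: complex_eq_iff)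
  qed
  ultimately show ?thesis by simp
qed

text \<open>In this form the second summand is the derivative of
  \<open>Ln (1 - exp (- 2 * w))\<close>, ready for integration by parts.\<close>

lemma coth_exp:
  assumes "0 < Re w"
  shows "cosh w / sinh w = 1 + 2 * exp (- 2 * w) / (1 - exp (- 2 * w))"
proof -
  have e: "exp (- 2 * w) = exp (- w) * exp (- w)" by (simp flip: exp_add)
  have E: "exp w * exp (- w) = 1" by (simp flip: exp_add)
  have cs: "cosh w = exp w * (1 + exp (- 2 * w)) / 2" "sinh w = exp w * (1 - exp (- 2 * w)) / 2"
    unfolding e using E by (simp_all add: cosh_field_def sinh_field_def ring_distribs flip: mult.assoc)
  have "cosh w / sinh w = (1 + exp (- 2 * w)) / (1 - exp (- 2 * w))"
    unfolding cs by simp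
  then show ?thesis
    using exp_minus_2_neq_1[OF assms] by (simp add: field_simps)
qed

text \<open>Integration by parts of \<open>w * coth w\<close>: with
  \<open>e = exp (- 2 * w)\<close>, half the dilogarithm of \<open>e\<close> is a primitive of
  \<open>Ln (1 - e)\<close>.\<close>

definition coth_primitive_1 :: "complex \<Rightarrow> complex" where
  "coth_primitive_1 w = w ^ 2 / 2 + w * Ln (1 - exp (- 2 * w))
     - eval_fps (polylog_fps 2) (exp (- 2 * w)) / 2"

text \<open>Integration by parts twice for \<open>w ^ 2 * coth w\<close>; the trilogarithm enters
  because its derivative in \<open>w\<close> is \<open>-2\<close> times the dilogarithm.\<close>

definition coth_primitive_2 :: "complex \<Rightarrow> complex" where
  "coth_primitive_2 w = w ^ 3 / 3 + w ^ 2 * Ln (1 - exp (- 2 * w))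
     - w * eval_fps (polylog_fps 2) (exp (- 2 * w)) - eval_fps (polylog_fps 3) (exp (- 2 * w)) / 2"

lemma has_field_derivative_Ln_one_minus_exp:
  assumes "0 < Re w"
  shows "((\<lambda>w. Ln (1 - exp (- 2 * w))) has_field_derivative
    2 * exp (- 2 * w) / (1 - exp (- 2 * w))) (at w)"
proof -
  have "1 - exp (- 2 * w) \<notin> \<real>\<^sub>\<le>\<^sub>0"
    using Re_one_minus_exp_pos[of w] exp_minus_2_neq_1[OF assms] assms
    by (auto simp: complex_nonpos_Reals_iff)
  moreover have "((\<lambda>w. 1 - exp (- 2 * w)) has_field_derivative 2 * exp (- 2 * w)) (at w)"
    by (auto intro!: derivative_eq_intros)
  ultimately have "((\<lambda>w. Ln (1 - exp (- 2 * w))) has_field_derivative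
      inverse (1 - exp (- 2 * w)) * (2 * exp (- 2 * w))) (at w)"
    by (intro DERIV_chain2[OF has_field_derivative_Ln])
  then show ?thesis
    by (simp only: divide_inverse mult_ac)
qed

lemma eval_polylog_fps_1_exp:
  assumes "0 < Re w"
  shows "eval_fps (polylog_fps 1) (exp (- 2 * w)) = - Ln (1 - exp (- 2 * w))"
  using assms by (intro eval_polylog_fps_1) simp

lemma has_field_derivative_coth_primitive_1:
  assumes w: "0 < Re w"
  shows "(coth_primitive_1 has_field_derivative w * cosh w / sinh w) (at w)"
proof -
  let ?l = "Ln (1 - exp (- 2 * w))" and ?q = "2 * exp (- 2 * w) / (1 - exp (- 2 * w))"
  have li2: "((\<lambda>w. eval_fps (polylog_fps 2) (exp (- 2 * w))) has_field_derivative 2 * ?l) (at w)"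
    using has_field_derivative_polylog_exp[OF order.refl w] eval_polylog_fps_1_exp[OF w]
    by (simp add: numeral_2_eq_2)
  have sq: "((\<lambda>w. w ^ 2 / 2) has_field_derivative w) (at w)"
    by (auto intro!: derivative_eq_intros)
  have "(coth_primitive_1 has_field_derivative w + (1 * ?l + ?q * w) - 2 * ?l / 2) (at w)"
    unfolding coth_primitive_1_def
    by (intro DERIV_diff DERIV_add DERIV_mult DERIV_cdivide DERIV_ident sq li2
        has_field_derivative_Ln_one_minus_exp[OF w])
  also have "w + (1 * ?l + ?q * w) - 2 * ?l / 2 = w * (cosh w / sinh w)"
    unfolding coth_exp[OF w] by (simp add: algebra_simps)
  finally show ?thesis by simp
qed

lemma has_field_derivative_coth_primitive_2:
  assumes w: "0 < Re w"
  shows "(coth_primitive_2 has_field_derivative w ^ 2 * cosh w / sinh w) (at w)"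
proof -
  let ?l = "Ln (1 - exp (- 2 * w))" and ?li2 = "eval_fps (polylog_fps 2) (exp (- 2 * w))"
    and ?q = "2 * exp (- 2 * w) / (1 - exp (- 2 * w))"
  have li2: "((\<lambda>w. eval_fps (polylog_fps 2) (exp (- 2 * w))) has_field_derivative 2 * ?l) (at w)"
    using has_field_derivative_polylog_exp[OF order.refl w] eval_polylog_fps_1_exp[OF w]
    by (simp add: numeral_2_eq_2)
  have li3: "((\<lambda>w. eval_fps (polylog_fps 3) (exp (- 2 * w))) has_field_derivative - 2 * ?li2) (at w)"
    using has_field_derivative_polylog_exp[OF _ w, of 2] by (simp add: numeral_3_eq_3)
  have pow: "((\<lambda>w. w ^ 3 / 3) has_field_derivative w ^ 2) (at w)"
    "((\<lambda>w. w ^ 2) has_field_derivative 2 * w) (at w)"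
    by (auto intro!: derivative_eq_intros)
  have "(coth_primitive_2 has_field_derivative
      w ^ 2 + (2 * w * ?l + ?q * w ^ 2) - (1 * ?li2 + 2 * ?l * w) - (- 2 * ?li2) / 2) (at w)"
    unfolding coth_primitive_2_def
    by (intro DERIV_diff DERIV_add DERIV_mult DERIV_cdivide DERIV_ident pow li2 li3
        has_field_derivative_Ln_one_minus_exp[OF w])
  also have "w ^ 2 + (2 * w * ?l + ?q * w ^ 2) - (1 * ?li2 + 2 * ?l * w) - (- 2 * ?li2) / 2 =
      w ^ 2 * (cosh w / sinh w)"
    unfolding coth_exp[OF w] by (simp add: algebra_simps)
  finally show ?thesis by simp
qed

lemma continuous_on_Ln_one_minus_exp:
  "continuous_on {w. 0 \<le> Re w \<and> exp (- 2 * w) \<noteq> 1} (\<lambda>w. Ln (1 - exp (- 2 * w)))"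
proof (intro continuous_on_Ln continuous_intros)
  fix w :: complex
  assume "w \<in> {w. 0 \<le> Re w \<and> exp (- 2 * w) \<noteq> 1}"
  then show "1 - exp (- 2 * w) \<notin> \<real>\<^sub>\<le>\<^sub>0"
    using Re_one_minus_exp_pos[of w] by (auto simp: complex_nonpos_Reals_iff)
qed

lemma continuous_on_coth_primitives:
  "continuous_on {w. 0 \<le> Re w \<and> exp (- 2 * w) \<noteq> 1} coth_primitive_1"
  "continuous_on {w. 0 \<le> Re w \<and> exp (- 2 * w) \<noteq> 1} coth_primitive_2"
proof -
  let ?S = "{w. 0 \<le> Re w \<and> exp (- 2 * w) \<noteq> 1}"
  have Li: "continuous_on ?S (\<lambda>w. eval_fps (polylog_fps k) (exp (- 2 * w)))" if "2 \<le> k" for k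
    by (rule continuous_on_subset[OF continuous_on_polylog_exp[OF that]]) auto
  show "continuous_on ?S coth_primitive_1"
    unfolding coth_primitive_1_def
    by (intro continuous_on_diff continuous_on_add continuous_on_mult continuous_on_divide
        continuous_on_power continuous_on_id continuous_on_const
        continuous_on_Ln_one_minus_exp Li) simp_all
  show "continuous_on ?S coth_primitive_2"
    unfolding coth_primitive_2_def
    by (intro continuous_on_diff continuous_on_add continuous_on_mult continuous_on_divide
        continuous_on_power continuous_on_id continuous_on_const
        continuous_on_Ln_one_minus_exp Li) simp_all
qed

section \<open>Limits of the primitives at the origin\<close>

lemma tendsto_polylog_exp_0:
  assumes "2 \<le> k"
  shows "((\<lambda>x. eval_fps (polylog_fps k) (exp (- 2 * of_real x))) \<longlongrightarrow>
    eval_fps (polylog_fps k) 1) (at_right (0::real))"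
proof -
  have "((\<lambda>x. exp (- 2 * of_real x) :: complex) \<longlongrightarrow> exp (- 2 * of_real 0)) (at_right (0::real))"
    by (intro tendsto_intros)
  moreover have "eventually (\<lambda>x. (exp (- 2 * of_real x) :: complex) \<in> cball 0 1) (at_right (0::real))"
    by (auto simp: eventually_at_filter intro!: always_eventually)
  ultimately show ?thesis
    by (intro continuous_on_tendsto_compose[OF continuous_on_eval_fps_cball[OF summable_polylog_fps[OF assms]]])
      simp_all
qed

text \<open>One factor \<open>x\<close> already outweighs the logarithmic singularity at
  \<open>0\<close>; the remaining power has a finite limit.\<close>

lemma tendsto_power_Ln_one_minus_exp_0:
  assumes "0 < m"
  shows "((\<lambda>x. of_real x ^ m * Ln (1 - exp (- 2 * of_real x))) \<longlongrightarrow> 0) (at_right (0::real))"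
proof -
  have "((\<lambda>x::real. x * ln (1 - exp (- 2 * x))) \<longlongrightarrow> 0) (at_right 0)"
    by real_asymp
  \<comment> \<open>For \<open>m = 1\<close> the limit is \<open>0 ^ 0 = 1\<close>; the product with
    the other limit is \<open>0\<close> in every case.\<close>
  moreover have "((\<lambda>x::real. x ^ (m - 1)) \<longlongrightarrow> 0 ^ (m - 1)) (at_right 0)"
    by (intro tendsto_intros)
  ultimately have "((\<lambda>x::real. x ^ (m - 1) * (x * ln (1 - exp (- 2 * x)))) \<longlongrightarrow> 0 ^ (m - 1) * 0) (at_right 0)"
    by (rule tendsto_mult[rotated])
  then have "((\<lambda>x::real. x ^ m * ln (1 - exp (- 2 * x))) \<longlongrightarrow> 0) (at_right 0)"
    using assms by (cases m) (simp_all add: mult_ac)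
  then have "((\<lambda>x::real. of_real (x ^ m * ln (1 - exp (- 2 * x))) :: complex) \<longlongrightarrow> of_real 0) (at_right 0)"
    by (rule tendsto_of_real)
  moreover have "eventually (\<lambda>x::real. of_real (x ^ m * ln (1 - exp (- 2 * x))) =
      of_real x ^ m * Ln (1 - exp (- 2 * of_real x))) (at_right 0)"
    unfolding eventually_at_filter
  proof (intro always_eventually allI impI)
    fix x :: real assume "x \<in> {0<..}"
    then have "Ln (of_real (1 - exp (- 2 * x))) = of_real (ln (1 - exp (- 2 * x)))"
      by (intro Ln_of_real) simp
    then show "of_real (x ^ m * ln (1 - exp (- 2 * x))) = of_real x ^ m * Ln (1 - exp (- 2 * of_real x))"
      by (simp flip: exp_of_real)
  qed
  ultimately show ?thesis
    by (simp only: of_real_0) (rule Lim_transform_eventually)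
qed

lemma tendsto_coth_primitive_1_0:
  "((\<lambda>x. coth_primitive_1 (of_real x)) \<longlongrightarrow> - eval_fps (polylog_fps 2) 1 / 2) (at_right 0)"
proof -
  have "((\<lambda>x. coth_primitive_1 (of_real x)) \<longlongrightarrow>
      of_real 0 ^ 2 / 2 + 0 - eval_fps (polylog_fps 2) 1 / 2) (at_right 0)"
    unfolding coth_primitive_1_def
    using tendsto_power_Ln_one_minus_exp_0[of 1]
    by (intro tendsto_intros tendsto_polylog_exp_0) simp_all
  then show ?thesis by simp
qed

lemma tendsto_coth_primitive_2_0:
  "((\<lambda>x. coth_primitive_2 (of_real x)) \<longlongrightarrow> - eval_fps (polylog_fps 3) 1 / 2) (at_right 0)"
proof -
  have "((\<lambda>x. coth_primitive_2 (of_real x)) \<longlongrightarrow> of_real 0 ^ 3 / 3 + 0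
      - of_real 0 * eval_fps (polylog_fps 2) 1 - eval_fps (polylog_fps 3) 1 / 2) (at_right 0)"
    unfolding coth_primitive_2_def
    by (intro tendsto_intros tendsto_polylog_exp_0 tendsto_power_Ln_one_minus_exp_0) simp_all
  then show ?thesis by simp
qed

subsection \<open>The series with central binomial coefficients\<close>

text \<open>These are the Taylor coefficients of \<open>(1 - x)\<close> to the power
  \<open>-1/2\<close>.\<close>

definition central :: "nat \<Rightarrow> real" where
  "central m = real ((2 * m) choose m) / 4 ^ m"

lemma central_pos: "0 < central m"
  by (simp add: central_def)

lemma central_le_1: "central m \<le> 1"
proof -
  have "real ((2 * m) choose m) \<le> real (2 ^ (2 * m))"
    using binomial_le_pow2 of_nat_le_iff by blast
  then show ?thesis by (simp add: central_def power_mult)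
qed

text \<open>This bounds the reciprocals, so that the terms
  \<open>1 / (4 * m ^ 3 * central m)\<close> are at most \<open>1 / (2 * m ^ 2)\<close> and the
  second series converges absolutely.\<close>

lemma central_ge:
  assumes "0 < m"
  shows "1 / (2 * real m) \<le> central m"
  using central_binomial_lower_bound[OF assms] assms by (simp add: central_def field_simps)

text \<open>Two applications of the absorption identity, linked by the symmetry of the two middle
  binomial coefficients in row \<open>2 * m + 1\<close>.\<close>

lemma central_Suc: "2 * (real m + 1) * central (Suc m) = (2 * real m + 1) * central m"
proof -
  have "Suc m * (2 * Suc m choose Suc m) = (2 * m + 2) * (Suc (2 * m) choose m)"
    using Suc_times_binomial_eq[of "Suc (2 * m)" m] by (simp add: mult_ac)
  moreover have "Suc (2 * m) choose m = Suc (2 * m) choose Suc m"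
    using binomial_symmetric[of m "Suc (2 * m)"] by simp
  moreover have "Suc m * (Suc (2 * m) choose Suc m) = (2 * m + 1) * (2 * m choose m)"
    using Suc_times_binomial_eq[of "2 * m" m] by (simp add: mult_ac)
  moreover have "2 * m + 2 = 2 * Suc m" by simp
  ultimately have "Suc m * (2 * Suc m choose Suc m) = 2 * ((2 * m + 1) * (2 * m choose m))"
    by (simp only: mult.assoc)
  from arg_cong[OF this, of real]
  have eq: "(1 + real m) * real (2 * Suc m choose Suc m) = 2 * ((2 * real m + 1) * real (2 * m choose m))"
    unfolding of_nat_mult of_nat_add of_nat_Suc of_nat_numeral of_nat_1 .
  have "2 * (real m + 1) * central (Suc m) =
      2 * ((1 + real m) * real (2 * Suc m choose Suc m)) / 4 ^ Suc m"
    by (simp only: central_def mult.assoc times_divide_eq_right add.commute)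
  also have "\<dots> = (2 * real m + 1) * central m"
    unfolding eq by (simp add: central_def)
  finally show ?thesis .
qed

text \<open>In degree \<open>n\<close> the term \<open>x\<^sup>2 f''\<close> contributes
  \<open>n * (n - 1)\<close> times the coefficient of \<open>f\<close> and \<open>x f'\<close>
  contributes \<open>n\<close> times it, together \<open>n ^ 2\<close>.\<close>

lemma fps_ode_of_recurrence:
  fixes f :: "complex fps"
  assumes "\<And>n. of_nat ((n + 2) * (n + 1)) * fps_nth f (n + 2) + of_nat (n ^ 2) * fps_nth f n =
    (if n = 0 then c else 0)"
  shows "(1 + fps_X ^ 2) * fps_deriv (fps_deriv f) + fps_X * fps_deriv f = fps_const c"
proof (rule fps_ext)
  fix n
  have "fps_nth ((1 + fps_X ^ 2) * fps_deriv (fps_deriv f) + fps_X * fps_deriv f) n =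
      of_nat ((n + 2) * (n + 1)) * fps_nth f (n + 2) + of_nat (n ^ 2) * fps_nth f n"
  proof (cases n)
    case (Suc m)
    show ?thesis
      unfolding Suc by (cases m; simp add: distrib_right fps_X_power_mult_nth)
        (simp add: power2_eq_square algebra_simps)
  qed (simp add: ring_distribs fps_X_power_mult_nth)
  then show "fps_nth ((1 + fps_X ^ 2) * fps_deriv (fps_deriv f) + fps_X * fps_deriv f) n =
      fps_nth (fps_const c) n"
    using assms[of n] by simp
qed

text \<open>
  The expansions of the integrals from \<open>0\<close> to \<open>x\<close> of \<open>arsinh t / t\<close> and \<open>arsinh\<^sup>2 t / t\<close>. In the
  second one the constant coefficient is \<open>0\<close> because of the division by zero.
\<close>

definition arsinh_fps :: "complex fps" where
  "arsinh_fps = Abs_fps (\<lambda>n. if even n then 0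
     else of_real ((- 1) ^ (n div 2) * central (n div 2) / real n ^ 2))"

definition arsinh_sq_fps :: "complex fps" where
  "arsinh_sq_fps = Abs_fps (\<lambda>n. if odd n then 0
     else of_real ((- 1) ^ Suc (n div 2) / (4 * real (n div 2) ^ 3 * central (n div 2))))"

text \<open>A common majorant of both series. The factor \<open>2\<close> comes from the second one,
  where \<open>n = 2 * m\<close> turns the bound \<open>1 / (2 * m ^ 2)\<close> into
  \<open>2 / n ^ 2\<close>.\<close>

lemma summable_2_inverse_squares: "summable (\<lambda>n. 2 * inverse (real n ^ 2))"
  by (intro summable_mult inverse_power_summable) simp

lemma summable_arsinh_fps: "summable (\<lambda>n. norm (fps_nth arsinh_fps n))"
proof (rule summable_comparison_test'[OF summable_2_inverse_squares])
  fix n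
  have "central (n div 2) / real n ^ 2 \<le> 2 / real n ^ 2"
    using central_le_1[of "n div 2"] by (intro divide_right_mono) simp_all
  then show "norm (norm (fps_nth arsinh_fps n)) \<le> 2 * inverse (real n ^ 2)"
    using central_pos[of "n div 2"]
    by (simp add: arsinh_fps_def norm_mult norm_inverse norm_power divide_inverse)
qed

lemma summable_arsinh_sq_fps: "summable (\<lambda>n. norm (fps_nth arsinh_sq_fps n))"
proof (rule summable_comparison_test'[OF summable_2_inverse_squares])
  fix n
  show "norm (norm (fps_nth arsinh_sq_fps n)) \<le> 2 * inverse (real n ^ 2)"
  proof (cases "even n \<and> n \<noteq> 0")
    case True
    then obtain m where m: "n = 2 * m" "0 < m" by (auto elim: evenE)
    have "2 * real m ^ 2 \<le> 4 * real m ^ 3 * central m"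
      using mult_left_mono[OF central_ge[OF m(2)], of "4 * real m ^ 3"] m(2)
      by (simp add: power2_eq_square power3_eq_cube)
    then have "1 / (4 * real m ^ 3 * central m) \<le> 1 / (2 * real m ^ 2)"
      using m(2) by (intro divide_left_mono mult_pos_pos central_pos) simp_all
    then show ?thesis
      using central_pos[of m] m
      by (simp add: arsinh_sq_fps_def norm_mult norm_divide norm_power field_simps)
  qed (auto simp: arsinh_sq_fps_def)
qed

text \<open>Here \<open>f\<close> is the series of \<open>arsinh\<close>, with coefficients
  \<open>(- 1) ^ k * central k / (2 * k + 1)\<close> in degree \<open>2 * k + 1\<close>. The
  recurrence for them is \<open>central_Suc\<close> up to sign.\<close>

lemma arsinh_fps_ode:
  defines "f \<equiv> fps_X * fps_deriv arsinh_fps"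
  shows "(1 + fps_X ^ 2) * fps_deriv (fps_deriv f) + fps_X * fps_deriv f = fps_const 0"
proof (rule fps_ode_of_recurrence)
  fix n
  have f: "fps_nth f k = of_nat k * fps_nth arsinh_fps k" for k
    by (cases k) (simp_all add: f_def)
  show "of_nat ((n + 2) * (n + 1)) * fps_nth f (n + 2) + of_nat (n ^ 2) * fps_nth f n =
    (if n = 0 then 0 else 0)"
  proof (cases "even n")
    case False
    then obtain m where n: "n = 2 * m + 1" by (elim oddE)
    have f': "fps_nth f (2 * k + 1) = of_real ((- 1) ^ k * central k / (2 * real k + 1))" for k
    proof -
      have "fps_nth f (2 * k + 1) =
          of_real (real (2 * k + 1)) * of_real ((- 1) ^ k * central k / real (2 * k + 1) ^ 2)"
        by (simp add: f arsinh_fps_def)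
      also have "\<dots> = of_real (real (2 * k + 1) * ((- 1) ^ k * central k / real (2 * k + 1) ^ 2))"
        by (simp only: of_real_mult)
      also have "real (2 * k + 1) * ((- 1) ^ k * central k / real (2 * k + 1) ^ 2) =
          (- 1) ^ k * central k / (2 * real k + 1)"
        by (simp add: power2_eq_square divide_simps)
      finally show ?thesis .
    qed
    have "real ((n + 2) * (n + 1)) * ((- 1) ^ Suc m * central (Suc m) / (2 * real (Suc m) + 1)) =
        - ((- 1) ^ m * (2 * (real m + 1) * central (Suc m)))"
      unfolding n by (simp add: divide_simps) (simp add: algebra_simps)
    also have "\<dots> = - (real (n ^ 2) * ((- 1) ^ m * central m / (2 * real m + 1)))"
      unfolding central_Suc n by (simp add: divide_simps) (simp add: power2_eq_square algebra_simps)
    finally have zero: "real ((n + 2) * (n + 1)) * ((- 1) ^ Suc m * central (Suc m) / (2 * real (Suc m) + 1))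
        + real (n ^ 2) * ((- 1) ^ m * central m / (2 * real m + 1)) = 0"
      by simp
    have "fps_nth f n = of_real ((- 1) ^ m * central m / (2 * real m + 1))"
      unfolding n by (rule f')
    moreover have "fps_nth f (n + 2) =
        of_real ((- 1) ^ Suc m * central (Suc m) / (2 * real (Suc m) + 1))"
    proof -
      have "n + 2 = 2 * Suc m + 1" using n by simp
      then show ?thesis by (simp only: f')
    qed
    ultimately have "of_nat ((n + 2) * (n + 1)) * fps_nth f (n + 2) + of_nat (n ^ 2) * fps_nth f n =
        of_real (real ((n + 2) * (n + 1)) * ((- 1) ^ Suc m * central (Suc m) / (2 * real (Suc m) + 1))
        + real (n ^ 2) * ((- 1) ^ m * central m / (2 * real m + 1)))"
      by (simp only: of_real_add of_real_mult of_real_of_nat_eq)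
    then show ?thesis
      by (simp only: zero of_real_0 if_cancel)
  qed (simp add: f arsinh_fps_def)
qed

text \<open>Here \<open>f\<close> is the series of the square of \<open>arsinh\<close>, which is
  \<open>w ^ 2\<close> in the variable \<open>w\<close>; hence the right side
  \<open>2\<close>.\<close>

lemma arsinh_sq_fps_ode:
  defines "f \<equiv> fps_X * fps_deriv arsinh_sq_fps"
  shows "(1 + fps_X ^ 2) * fps_deriv (fps_deriv f) + fps_X * fps_deriv f = fps_const 2"
proof (rule fps_ode_of_recurrence)
  fix n
  have f: "fps_nth f k = of_nat k * fps_nth arsinh_sq_fps k" for k
    by (cases k) (simp_all add: f_def)
  show "of_nat ((n + 2) * (n + 1)) * fps_nth f (n + 2) + of_nat (n ^ 2) * fps_nth f n =
    (if n = 0 then 2 else 0)"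
  proof (cases "even n")
    case True
    then obtain m where n: "n = 2 * m" by (elim evenE)
    \<comment> \<open>For \<open>k = 0\<close> both sides are \<open>0\<close>, the right one by
      division by zero.\<close>
    have f': "fps_nth f (2 * k) = of_real ((- 1) ^ Suc k / (2 * real k ^ 2 * central k))" for k
      by (cases "k = 0") (simp_all add: f arsinh_sq_fps_def power2_eq_square power3_eq_cube)
    define v where "v = central (Suc m)"
    have v: "0 < v" unfolding v_def by (rule central_pos)
    \<comment> \<open>Expressing \<open>central m\<close> through \<open>central (Suc m)\<close>
      gives both terms of the recurrence the same denominator.\<close>
    have u: "central m = 2 * (real m + 1) * v / (2 * real m + 1)"
      using central_Suc[of m] by (simp add: v_def field_simps)
    have rec: "real ((n + 2) * (n + 1)) * ((- 1) ^ Suc (Suc m) / (2 * real (Suc m) ^ 2 * v))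
        + real (n ^ 2) * ((- 1) ^ Suc m / (2 * real m ^ 2 * central m)) = (if n = 0 then 2 else 0)"
    proof (cases "m = 0")
      case True
      \<comment> \<open>The inhomogeneity arises only in degree \<open>0\<close>: the second summand
        has the factor \<open>0\<close>, and \<open>v = 1 / 2\<close> makes the first one
        \<open>2\<close>.\<close>
      have "v = 1 / 2" using u True by (simp add: central_def)
      then show ?thesis unfolding n True by (simp only:) simp
    next
      case False
      have "real ((n + 2) * (n + 1)) * ((- 1) ^ Suc (Suc m) / (2 * real (Suc m) ^ 2 * v)) =
          (- 1) ^ m * ((2 * real m + 1) / ((real m + 1) * v))"
        unfolding n using v by (simp add: divide_simps) (simp add: power2_eq_square algebra_simps)
      moreover have "real (n ^ 2) * ((- 1) ^ Suc m / (2 * real m ^ 2 * central m)) =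
          - ((- 1) ^ m * ((2 * real m + 1) / ((real m + 1) * v)))"
        unfolding n u using v False by (simp add: divide_simps)
      ultimately show ?thesis using False n by simp
    qed
    have "fps_nth f n = of_real ((- 1) ^ Suc m / (2 * real m ^ 2 * central m))"
      unfolding n by (rule f')
    moreover have "fps_nth f (n + 2) = of_real ((- 1) ^ Suc (Suc m) / (2 * real (Suc m) ^ 2 * v))"
    proof -
      have "n + 2 = 2 * Suc m" using n by simp
      then show ?thesis by (simp only: f' v_def)
    qed
    ultimately have "of_nat ((n + 2) * (n + 1)) * fps_nth f (n + 2) + of_nat (n ^ 2) * fps_nth f n =
        of_real (real ((n + 2) * (n + 1)) * ((- 1) ^ Suc (Suc m) / (2 * real (Suc m) ^ 2 * v))
        + real (n ^ 2) * ((- 1) ^ Suc m / (2 * real m ^ 2 * central m)))"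
      by (simp only: of_real_add of_real_mult of_real_of_nat_eq)
    then show ?thesis
      unfolding rec by simp
  qed (auto simp: f arsinh_sq_fps_def elim: oddE)
qed

text \<open>The linear coefficients here and in the next lemma select the solutions \<open>w\<close>
  (with \<open>c = 0\<close>) and \<open>w ^ 2\<close> (with \<open>c = 2\<close>) of
  \<open>y'' = c\<close>.\<close>

lemma fps_nth_X_deriv_arsinh_fps_1: "fps_nth (fps_X * fps_deriv arsinh_fps) 1 = 1"
  by (simp add: arsinh_fps_def central_def)

lemma fps_nth_X_deriv_arsinh_sq_fps_1: "fps_nth (fps_X * fps_deriv arsinh_sq_fps) 1 = 0"
  by (simp add: arsinh_sq_fps_def)

text \<open>The added constant is the negative of the limit of the primitive at \<open>0\<close>;
  the same holds for the second series.\<close>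

lemma eval_arsinh_fps_sinh:
  assumes "a \<in> closure right_sinh_region" "0 \<le> Re a" "exp (- 2 * a) \<noteq> 1" "norm (sinh a) \<le> 1"
  shows "eval_fps arsinh_fps (sinh a) = coth_primitive_1 a + eval_fps (polylog_fps 2) 1 / 2"
proof -
  have "fps_nth arsinh_fps 0 = 0" by (simp add: arsinh_fps_def)
  then have "eval_fps arsinh_fps (sinh a) = coth_primitive_1 a - (- eval_fps (polylog_fps 2) 1 / 2)"
    using has_field_derivative_coth_primitive_1
    by (intro eval_fps_sinh_primitive[OF summable_arsinh_fps _ refl arsinh_fps_ode _
          continuous_on_coth_primitives(1) tendsto_coth_primitive_1_0 assms])
      (simp_all only: fps_nth_X_deriv_arsinh_fps_1 mult_1 mult_zero_left div_0 add_0_right)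
  then show ?thesis by simp
qed

lemma eval_arsinh_sq_fps_sinh:
  assumes "a \<in> closure right_sinh_region" "0 \<le> Re a" "exp (- 2 * a) \<noteq> 1" "norm (sinh a) \<le> 1"
  shows "eval_fps arsinh_sq_fps (sinh a) = coth_primitive_2 a + eval_fps (polylog_fps 3) 1 / 2"
proof -
  have "fps_nth arsinh_sq_fps 0 = 0" by (simp add: arsinh_sq_fps_def)
  moreover have "0 * w + 2 * w ^ 2 / 2 = w ^ 2" for w :: complex by simp
  ultimately have "eval_fps arsinh_sq_fps (sinh a) =
      coth_primitive_2 a - (- eval_fps (polylog_fps 3) 1 / 2)"
    using has_field_derivative_coth_primitive_2
    by (intro eval_fps_sinh_primitive[OF summable_arsinh_sq_fps _ refl arsinh_sq_fps_ode _
          continuous_on_coth_primitives(2) tendsto_coth_primitive_2_0 assms])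
      (simp_all only: fps_nth_X_deriv_arsinh_sq_fps_1)
  then show ?thesis by simp
qed

section \<open>The two evaluation points on the boundary\<close>

lemma arsinh_1_in_closure: "of_real (arsinh 1) \<in> closure right_sinh_region"
  using closure_right_sinh_region[of 1 0] by (simp add: complex_of_real_def)

lemma i_pi_half_in_closure: "\<i> * of_real (pi / 2) \<in> closure right_sinh_region"
  using closure_right_sinh_region[of 0 "pi / 2"] by (simp add: Complex_eq)

lemma sinh_i_pi_half: "sinh (\<i> * of_real (pi / 2)) = \<i>"
  by (simp add: sinh_conv_sin flip: sin_of_real)

lemma sinh_of_real_arsinh_1: "sinh (of_real (arsinh 1)) = (1 :: complex)"
proof -
  have "sinh (of_real x) = (of_real (sinh x) :: complex)" for x :: real
    by (simp add: sinh_field_def exp_of_real flip: of_real_minus)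
  then show ?thesis by simp
qed

lemma exp_minus_i_pi: "exp (- 2 * (\<i> * of_real (pi / 2))) = - 1"
  by (simp add: exp_minus)

section \<open>Selecting terms by parity, and special values of polylogarithms\<close>

lemma strict_mono_double: "strict_mono (\<lambda>n::nat. 2 * n)" "strict_mono (\<lambda>n::nat. Suc (2 * n))"
  by (auto simp: strict_mono_def)

lemma range_double: "n \<in> range (\<lambda>n::nat. 2 * n) \<longleftrightarrow> even n"
  "n \<in> range (\<lambda>n::nat. Suc (2 * n)) \<longleftrightarrow> odd n"
  by (auto elim: evenE oddE)

text \<open>The mean of \<open>a n\<close> and \<open>(- 1) ^ n * a n\<close> is \<open>a n\<close>
  for even \<open>n\<close> and \<open>0\<close> for odd \<open>n\<close>, so dropping the odd
  indices preserves the sum.\<close>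

lemma sums_even_terms:
  fixes a :: "nat \<Rightarrow> real"
  assumes "a sums A" and "(\<lambda>n. (- 1) ^ n * a n) sums B"
  shows "(\<lambda>r. a (2 * r)) sums ((A + B) / 2)"
proof -
  have "(\<lambda>n. (a n + (- 1) ^ n * a n) / 2) sums ((A + B) / 2)"
    by (intro sums_divide sums_add assms)
  then have "(\<lambda>r. (a (2 * r) + (- 1) ^ (2 * r) * a (2 * r)) / 2) sums ((A + B) / 2)"
    by (subst sums_mono_reindex[OF strict_mono_double(1)])
      (auto simp only: range_double, simp)
  then show ?thesis by simp
qed

text \<open>Adding the series at \<open>1\<close> and \<open>- 1\<close> leaves the terms
  \<open>2 / (2 * n) ^ k\<close>. Thus the value at \<open>- 1\<close> is
  \<open>2 / 2 ^ k - 1\<close> times the value at \<open>1\<close>.\<close>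

lemma polylog_fps_duplication:
  assumes "2 \<le> k"
  shows "eval_fps (polylog_fps k) 1 + eval_fps (polylog_fps k) (- 1) =
    2 / 2 ^ k * eval_fps (polylog_fps k) 1"
proof -
  let ?A = "eval_fps (polylog_fps k) 1" and ?B = "eval_fps (polylog_fps k) (- 1)"
  have A: "(\<lambda>n. 1 / of_nat n ^ k) sums ?A"
    using sums_eval_fps_cball[OF summable_polylog_fps[OF assms], of 1]
    by (simp add: polylog_fps_def)
  have B: "(\<lambda>n. (- 1) ^ n / of_nat n ^ k) sums ?B"
    using sums_eval_fps_cball[OF summable_polylog_fps[OF assms], of "- 1"]
    by (simp add: polylog_fps_def)
  have "(\<lambda>n. 1 / of_nat n ^ k + (- 1) ^ n / of_nat n ^ k) sums (?A + ?B)"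
    by (intro sums_add A B)
  then have "(\<lambda>n. 1 / of_nat (2 * n) ^ k + (- 1) ^ (2 * n) / of_nat (2 * n) ^ k) sums (?A + ?B)"
    by (subst sums_mono_reindex[OF strict_mono_double(1)])
      (auto simp only: range_double, simp)
  moreover have "(\<lambda>n. 2 / 2 ^ k * (1 / of_nat n ^ k)) sums (2 / 2 ^ k * ?A)"
    by (intro sums_mult A)
  ultimately show ?thesis
    by (intro sums_unique2) (simp_all add: power_mult_distrib mult_ac)
qed

lemma eval_polylog_fps_of_real:
  assumes "0 < k" "\<bar>x\<bar> < 1"
  shows "eval_fps (polylog_fps k) (of_real x) = of_real (polylog k x)"
proof -
  have "(\<lambda>n. x ^ n / real n ^ k) sums polylog k x"
    \<comment> \<open>The additional term at index \<open>0\<close> vanishes because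
      \<open>k > 0\<close> makes its denominator \<open>0\<close>.\<close>
    by (rule sums_Suc_imp) (use polylog_sums[OF assms(2), of k] assms(1) in simp_all)
  then have "(\<lambda>n. of_real (x ^ n / real n ^ k) :: complex) sums of_real (polylog k x)"
    by (rule sums_of_real)
  then show ?thesis
    by (simp add: eval_fps_def polylog_fps_def sums_iff)
qed

lemma eval_polylog_fps_2_1: "eval_fps (polylog_fps 2) 1 = of_real (pi ^ 2 / 6)"
proof -
  have "(\<lambda>n. 1 / real n ^ 2) sums (pi ^ 2 / 6)"
    by (rule sums_Suc_imp) (use inverse_squares_sums in \<open>simp_all add: add_ac\<close>)
  then have "(\<lambda>n. of_real (1 / real n ^ 2) :: complex) sums of_real (pi ^ 2 / 6)"
    by (rule sums_of_real)
  then show ?thesis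
    by (simp add: eval_fps_def polylog_fps_def sums_iff)
qed

lemma eval_polylog_fps_3_1: "eval_fps (polylog_fps 3) 1 = of_real (zeta 3)"
proof -
  have "(\<lambda>n. 1 / real (Suc n) ^ 3) sums zeta 3"
    using zeta_sums[of 3] by (simp add: powr_minus divide_inverse)
  then have "(\<lambda>n. 1 / real n ^ 3) sums zeta 3"
    by (intro sums_Suc_imp[of "\<lambda>n. 1 / real n ^ 3"]) simp_all
  then have "(\<lambda>n. of_real (1 / real n ^ 3) :: complex) sums of_real (zeta 3)"
    by (rule sums_of_real)
  then show ?thesis
    by (simp add: eval_fps_def polylog_fps_def sums_iff)
qed

subsection \<open>Evaluation at \<open>1\<close> and \<open>\<i>\<close>\<close>

lemma eval_arsinh_fps_1_sums:
  "(\<lambda>m. (- 1) ^ m * (central m / (2 * real m + 1) ^ 2)) sums Re (eval_fps arsinh_fps 1)"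
proof -
  have "(\<lambda>n. fps_nth arsinh_fps n * 1 ^ n) sums eval_fps arsinh_fps 1"
    by (rule sums_eval_fps_cball[OF summable_arsinh_fps]) simp
  then have "(\<lambda>m. fps_nth arsinh_fps (Suc (2 * m)) * 1 ^ Suc (2 * m)) sums eval_fps arsinh_fps 1"
    by (subst sums_mono_reindex[OF strict_mono_double(2)])
      (simp_all only: range_double, simp add: arsinh_fps_def)
  then have "(\<lambda>m. Re (fps_nth arsinh_fps (Suc (2 * m)) * 1 ^ Suc (2 * m))) sums Re (eval_fps arsinh_fps 1)"
    by (rule sums_Re)
  moreover have "Re (fps_nth arsinh_fps (Suc (2 * m)) * 1 ^ Suc (2 * m)) =
      (- 1) ^ m * (central m / (2 * real m + 1) ^ 2)" for m
  proof -
    have "fps_nth arsinh_fps (Suc (2 * m)) = of_real ((- 1) ^ m * central m / real (Suc (2 * m)) ^ 2)"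
      by (simp add: arsinh_fps_def)
    then show ?thesis by (simp add: add.commute del: of_real_mult of_real_divide)
  qed
  ultimately show ?thesis by simp
qed

text \<open>Since \<open>\<i> ^ (2 * m + 1) = \<i> * (- 1) ^ m\<close>, the alternating sign of the
  coefficients cancels and the whole sum moves into the imaginary part.\<close>

lemma eval_arsinh_fps_i_sums:
  "(\<lambda>m. central m / (2 * real m + 1) ^ 2) sums Im (eval_fps arsinh_fps \<i>)"
proof -
  have "(\<lambda>n. fps_nth arsinh_fps n * \<i> ^ n) sums eval_fps arsinh_fps \<i>"
    by (rule sums_eval_fps_cball[OF summable_arsinh_fps]) simp
  then have "(\<lambda>m. fps_nth arsinh_fps (Suc (2 * m)) * \<i> ^ Suc (2 * m)) sums eval_fps arsinh_fps \<i>"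
    by (subst sums_mono_reindex[OF strict_mono_double(2)])
      (simp_all only: range_double, simp add: arsinh_fps_def)
  then have "(\<lambda>m. Im (fps_nth arsinh_fps (Suc (2 * m)) * \<i> ^ Suc (2 * m))) sums Im (eval_fps arsinh_fps \<i>)"
    by (rule sums_Im)
  moreover have "Im (fps_nth arsinh_fps (Suc (2 * m)) * \<i> ^ Suc (2 * m)) =
      central m / (2 * real m + 1) ^ 2" for m
  proof -
    have "fps_nth arsinh_fps (Suc (2 * m)) = of_real ((- 1) ^ m * central m / real (Suc (2 * m)) ^ 2)"
      by (simp add: arsinh_fps_def)
    moreover have "\<i> ^ Suc (2 * m) = \<i> * of_real ((- 1) ^ m)"
      by (simp add: power_mult)
    ultimately have "fps_nth arsinh_fps (Suc (2 * m)) * \<i> ^ Suc (2 * m) =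
        \<i> * of_real ((- 1) ^ m * central m / real (Suc (2 * m)) ^ 2 * (- 1) ^ m)"
      by (simp only: of_real_mult mult_ac)
    also have "(- 1) ^ m * central m / real (Suc (2 * m)) ^ 2 * (- 1) ^ m =
        central m / (2 * real m + 1) ^ 2"
      by (simp add: add.commute flip: power_mult_distrib)
    finally show ?thesis by (simp only: Im_i_times Re_complex_of_real)
  qed
  ultimately show ?thesis by simp
qed

lemma eval_arsinh_sq_fps_1_sums:
  "(\<lambda>m. (- 1) ^ m * (1 / (4 * real m ^ 3 * central m))) sums - Re (eval_fps arsinh_sq_fps 1)"
proof -
  have "(\<lambda>n. fps_nth arsinh_sq_fps n * 1 ^ n) sums eval_fps arsinh_sq_fps 1"
    by (rule sums_eval_fps_cball[OF summable_arsinh_sq_fps]) simp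
  then have "(\<lambda>m. fps_nth arsinh_sq_fps (2 * m) * 1 ^ (2 * m)) sums eval_fps arsinh_sq_fps 1"
    by (subst sums_mono_reindex[OF strict_mono_double(1)])
      (simp_all only: range_double, simp add: arsinh_sq_fps_def)
  then have "(\<lambda>m. - Re (fps_nth arsinh_sq_fps (2 * m) * 1 ^ (2 * m))) sums - Re (eval_fps arsinh_sq_fps 1)"
    by (intro sums_minus sums_Re)
  moreover have "- Re (fps_nth arsinh_sq_fps (2 * m) * 1 ^ (2 * m)) =
      (- 1) ^ m * (1 / (4 * real m ^ 3 * central m))" for m
  proof -
    have "fps_nth arsinh_sq_fps (2 * m) = of_real ((- 1) ^ Suc m / (4 * real m ^ 3 * central m))"
      by (simp add: arsinh_sq_fps_def)
    then show ?thesis by (simp del: of_real_mult of_real_divide)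
  qed
  ultimately show ?thesis by simp
qed

text \<open>Since \<open>\<i> ^ (2 * m) = (- 1) ^ m\<close>, only one sign of the factor
  \<open>(- 1) ^ Suc m\<close> survives, whence the negated real part.\<close>

lemma eval_arsinh_sq_fps_i_sums:
  "(\<lambda>m. 1 / (4 * real m ^ 3 * central m)) sums - Re (eval_fps arsinh_sq_fps \<i>)"
proof -
  have "(\<lambda>n. fps_nth arsinh_sq_fps n * \<i> ^ n) sums eval_fps arsinh_sq_fps \<i>"
    by (rule sums_eval_fps_cball[OF summable_arsinh_sq_fps]) simp
  then have "(\<lambda>m. fps_nth arsinh_sq_fps (2 * m) * \<i> ^ (2 * m)) sums eval_fps arsinh_sq_fps \<i>"
    by (subst sums_mono_reindex[OF strict_mono_double(1)])
      (simp_all only: range_double, simp add: arsinh_sq_fps_def)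
  then have "(\<lambda>m. - Re (fps_nth arsinh_sq_fps (2 * m) * \<i> ^ (2 * m))) sums - Re (eval_fps arsinh_sq_fps \<i>)"
    by (intro sums_minus sums_Re)
  moreover have "- Re (fps_nth arsinh_sq_fps (2 * m) * \<i> ^ (2 * m)) =
      1 / (4 * real m ^ 3 * central m)" for m
  proof -
    have "fps_nth arsinh_sq_fps (2 * m) = of_real ((- 1) ^ Suc m / (4 * real m ^ 3 * central m))"
      by (simp add: arsinh_sq_fps_def)
    moreover have "\<i> ^ (2 * m) = of_real ((- 1) ^ m)"
      by (simp add: power_mult)
    ultimately have "fps_nth arsinh_sq_fps (2 * m) * \<i> ^ (2 * m) =
        of_real ((- 1) ^ Suc m / (4 * real m ^ 3 * central m) * (- 1) ^ m)"
      by (simp only: of_real_mult)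
    also have "(- 1) ^ Suc m / (4 * real m ^ 3 * central m) * (- 1) ^ m =
        - (1 / (4 * real m ^ 3 * central m))"
      by (simp flip: power_mult_distrib)
    finally show ?thesis by (simp del: of_real_divide of_real_mult)
  qed
  ultimately show ?thesis by simp
qed

section \<open>Values at \<open>w = arsinh 1\<close>, where \<open>exp (- 2 * w)\<close> is
  \<open>(sqrt 2 - 1) ^ 2\<close>\<close>

lemma exp_minus_2_arsinh_1: "exp (- 2 * of_real (arsinh 1)) = (of_real ((sqrt 2 - 1) ^ 2) :: complex)"
proof -
  have "exp (- 2 * arsinh (1::real)) = exp (- arsinh 1) * exp (- arsinh 1)"
    by (simp flip: exp_add)
  also have "\<dots> = (sqrt 2 - 1) ^ 2"
    unfolding sqrt2_minus_1_eq by (simp add: power2_eq_square)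
  finally have "of_real (exp (- 2 * arsinh (1::real))) = (of_real ((sqrt 2 - 1) ^ 2) :: complex)"
    by (rule arg_cong)
  then show ?thesis
    by (simp flip: exp_of_real)
qed

text \<open>The number \<open>sqrt 2 - 1\<close> solves \<open>1 - x ^ 2 = 2 * x\<close>, and its
  logarithm is \<open>- arsinh 1\<close>.\<close>

lemma ln_one_minus_sqrt2_minus_1_sq:
  "0 < 1 - (sqrt 2 - 1) ^ 2" "ln (1 - (sqrt 2 - 1) ^ 2) = ln 2 - arsinh (1::real)"
proof -
  have eq: "1 - (sqrt 2 - 1) ^ 2 = 2 * (sqrt 2 - 1)"
    by (simp add: power2_eq_square algebra_simps)
  show "0 < 1 - (sqrt 2 - 1) ^ 2"
    unfolding eq by simp
  show "ln (1 - (sqrt 2 - 1) ^ 2) = ln 2 - arsinh (1::real)"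
    unfolding eq by (subst ln_mult) (simp_all add: sqrt2_minus_1_eq)
qed

lemma Ln_one_minus_exp_arsinh_1:
  "Ln (1 - exp (- 2 * of_real (arsinh 1))) = of_real (ln 2 - arsinh 1)"
proof -
  have "Ln (1 - of_real ((sqrt 2 - 1) ^ 2)) = Ln (of_real (1 - (sqrt 2 - 1) ^ 2))"
    by (simp only: of_real_diff of_real_1)
  also have "\<dots> = of_real (ln (1 - (sqrt 2 - 1) ^ 2))"
    by (rule Ln_of_real) (rule ln_one_minus_sqrt2_minus_1_sq(1))
  finally show ?thesis
    by (simp only: exp_minus_2_arsinh_1 ln_one_minus_sqrt2_minus_1_sq(2))
qed

lemma eval_polylog_fps_arsinh_1:
  assumes "0 < k"
  shows "eval_fps (polylog_fps k) (exp (- 2 * of_real (arsinh 1))) =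
    of_real (polylog k ((sqrt 2 - 1) ^ 2))"
  unfolding exp_minus_2_arsinh_1
  by (rule eval_polylog_fps_of_real[OF assms]) (use ln_one_minus_sqrt2_minus_1_sq(1) in simp)

lemma arsinh_1_pos: "0 \<le> arsinh (1::real)"
  by (rule less_imp_le) simp

lemma Re_eval_arsinh_fps_1:
  "Re (eval_fps arsinh_fps 1) =
    arsinh 1 * ln 2 - arsinh 1 ^ 2 / 2 - polylog 2 ((sqrt 2 - 1) ^ 2) / 2 + pi ^ 2 / 12"
proof -
  let ?L = "arsinh (1::real)"
  have "exp (- 2 * of_real ?L) \<noteq> (1 :: complex)"
    by (rule exp_minus_2_neq_1) simp
  then have "eval_fps arsinh_fps 1 = coth_primitive_1 (of_real ?L) + eval_fps (polylog_fps 2) 1 / 2"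
    using eval_arsinh_fps_sinh[OF arsinh_1_in_closure] arsinh_1_pos by (simp add: sinh_of_real_arsinh_1)
  also have "\<dots> = of_real (?L ^ 2 / 2 + ?L * (ln 2 - ?L) - polylog 2 ((sqrt 2 - 1) ^ 2) / 2 + pi ^ 2 / 6 / 2)"
    unfolding coth_primitive_1_def Ln_one_minus_exp_arsinh_1 eval_polylog_fps_2_1
      eval_polylog_fps_arsinh_1[OF zero_less_numeral]
    by (simp only: of_real_add of_real_diff of_real_mult of_real_divide of_real_power of_real_numeral)
  finally show ?thesis
    by (simp only: Re_complex_of_real) (simp add: power2_eq_square algebra_simps)
qed

lemma Re_eval_arsinh_sq_fps_1:
  "Re (eval_fps arsinh_sq_fps 1) =
    arsinh 1 ^ 2 * ln 2 - 2 / 3 * arsinh 1 ^ 3 - arsinh 1 * polylog 2 ((sqrt 2 - 1) ^ 2)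
      - polylog 3 ((sqrt 2 - 1) ^ 2) / 2 + zeta 3 / 2"
proof -
  let ?L = "arsinh (1::real)"
  have "exp (- 2 * of_real ?L) \<noteq> (1 :: complex)"
    by (rule exp_minus_2_neq_1) simp
  then have "eval_fps arsinh_sq_fps 1 = coth_primitive_2 (of_real ?L) + eval_fps (polylog_fps 3) 1 / 2"
    using eval_arsinh_sq_fps_sinh[OF arsinh_1_in_closure] arsinh_1_pos by (simp add: sinh_of_real_arsinh_1)
  also have "\<dots> = of_real (?L ^ 3 / 3 + ?L ^ 2 * (ln 2 - ?L) - ?L * polylog 2 ((sqrt 2 - 1) ^ 2)
      - polylog 3 ((sqrt 2 - 1) ^ 2) / 2 + zeta 3 / 2)"
    unfolding coth_primitive_2_def Ln_one_minus_exp_arsinh_1 eval_polylog_fps_3_1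
      eval_polylog_fps_arsinh_1[OF zero_less_numeral]
    by (simp only: of_real_add of_real_diff of_real_mult of_real_divide of_real_power of_real_numeral)
  finally show ?thesis
    by (simp only: Re_complex_of_real) (simp add: power2_eq_square power3_eq_cube algebra_simps)
qed

section \<open>Values at \<open>w = \<i> * pi / 2\<close>, where \<open>exp (- 2 * w)\<close> is
  \<open>- 1\<close>\<close>

lemma eval_polylog_fps_minus_1:
  "eval_fps (polylog_fps 2) (- 1) = of_real (- (pi ^ 2 / 12))"
  "eval_fps (polylog_fps 3) (- 1) = of_real (- (3 / 4 * zeta 3))"
proof -
  have "eval_fps (polylog_fps 2) (- 1) = - (1 / 2 * eval_fps (polylog_fps 2) 1)"
    using polylog_fps_duplication[of 2] by (simp add: add_eq_0_iff2 field_simps)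
  then show "eval_fps (polylog_fps 2) (- 1) = of_real (- (pi ^ 2 / 12))"
    by (simp add: eval_polylog_fps_2_1)
  have "eval_fps (polylog_fps 3) (- 1) = - (3 / 4 * eval_fps (polylog_fps 3) 1)"
    using polylog_fps_duplication[of 3] by (simp add: field_simps) algebra
  then show "eval_fps (polylog_fps 3) (- 1) = of_real (- (3 / 4 * zeta 3))"
    by (simp add: eval_polylog_fps_3_1)
qed

text \<open>The double minus is the form that \<open>1 - exp (- 2 * w)\<close> takes after rewriting
  with \<open>exp_minus_i_pi\<close>.\<close>

lemma Ln_one_minus_exp_i_pi: "Ln (1 - - 1) = of_real (ln 2)"
  using Ln_of_real[of 2] by simp

lemma i_pi_half_power:
  "(\<i> * of_real (pi / 2)) ^ 2 = - of_real ((pi / 2) ^ 2)"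
  "(\<i> * of_real (pi / 2)) ^ 3 = - (\<i> * of_real ((pi / 2) ^ 3))"
  by (simp_all add: complex_eq_iff power2_eq_square power3_eq_cube)

text \<open>Of the terms of the primitive only \<open>w * Ln (1 - exp (- 2 * w))\<close> is not real
  at this point.\<close>

lemma Im_eval_arsinh_fps_i: "Im (eval_fps arsinh_fps \<i>) = pi / 2 * ln 2"
proof -
  let ?a = "\<i> * of_real (pi / 2)"
  have "eval_fps arsinh_fps \<i> = coth_primitive_1 ?a + eval_fps (polylog_fps 2) 1 / 2"
    using eval_arsinh_fps_sinh[OF i_pi_half_in_closure]
    unfolding sinh_i_pi_half exp_minus_i_pi by simp
  also have "\<dots> = of_real (- ((pi / 2) ^ 2 / 2) + pi ^ 2 / 12 / 2 + pi ^ 2 / 6 / 2) + \<i> * of_real (pi / 2 * ln 2)"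
    unfolding coth_primitive_1_def exp_minus_i_pi Ln_one_minus_exp_i_pi eval_polylog_fps_2_1
      eval_polylog_fps_minus_1 i_pi_half_power
    by simp
  finally show ?thesis by simp
qed

text \<open>The cubic and the dilogarithm term are purely imaginary. The trilogarithm at
  \<open>- 1\<close> contributes \<open>3 / 8 * zeta 3\<close> and the constant of integration
  \<open>zeta 3 / 2\<close>.\<close>

lemma Re_eval_arsinh_sq_fps_i:
  "Re (eval_fps arsinh_sq_fps \<i>) = - (pi ^ 2 / 4 * ln 2) + 7 / 8 * zeta 3"
proof -
  let ?a = "\<i> * of_real (pi / 2)"
  have "eval_fps arsinh_sq_fps \<i> = coth_primitive_2 ?a + eval_fps (polylog_fps 3) 1 / 2"
    using eval_arsinh_sq_fps_sinh[OF i_pi_half_in_closure]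
    unfolding sinh_i_pi_half exp_minus_i_pi by simp
  also have "\<dots> = of_real (- (pi ^ 2 / 4 * ln 2) + 3 / 8 * zeta 3 + zeta 3 / 2)
      + \<i> * of_real (- ((pi / 2) ^ 3 / 3) + pi / 2 * (pi ^ 2 / 12))"
    unfolding coth_primitive_2_def exp_minus_i_pi Ln_one_minus_exp_i_pi eval_polylog_fps_3_1
      eval_polylog_fps_minus_1
    unfolding i_pi_half_power
    by (simp add: power2_eq_square power3_eq_cube)
  finally show ?thesis by simp
qed

theorem theorem9p1:
  fixes L \<rho> :: real
  assumes L: "L = arsinh 1"
    and rho: "\<rho> = sqrt 2 - 1"
  shows "(\<lambda>r. real ((4 * r) choose (2 * r)) / (16 ^ r * (4 * real r + 1) ^ 2)) sums
           (pi / 4 * ln 2 + L / 2 * ln 2 - L ^ 2 / 4 + pi ^ 2 / 24 - 1 / 4 * polylog 2 (\<rho> ^ 2))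
       \<and> (\<lambda>r. 16 ^ Suc r / (real (Suc r) ^ 3 * real ((4 * Suc r) choose (2 * Suc r)))) sums
           (4 * pi ^ 2 * ln 2 + 32 / 3 * L ^ 3 - 16 * L ^ 2 * ln 2 + 16 * L * polylog 2 (\<rho> ^ 2)
             + 8 * polylog 3 (\<rho> ^ 2) - 22 * zeta 3)"
proof
  have central: "central (2 * r) = real ((4 * r) choose (2 * r)) / 16 ^ r" for r
    by (simp add: central_def power_mult)
  \<comment> \<open>The even-indexed half of the series at \<open>\<i>\<close> (constant signs) and
    at \<open>1\<close> (alternating); \<open>m = 2 * r\<close> turns \<open>2 * m + 1\<close> into
    \<open>4 * r + 1\<close>.\<close>
  have "(\<lambda>r. central (2 * r) / (2 * real (2 * r) + 1) ^ 2) sums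
      ((pi / 2 * ln 2 + (L * ln 2 - L ^ 2 / 2 - polylog 2 (\<rho> ^ 2) / 2 + pi ^ 2 / 12)) / 2)"
    using sums_even_terms[OF eval_arsinh_fps_i_sums eval_arsinh_fps_1_sums]
    unfolding Im_eval_arsinh_fps_i Re_eval_arsinh_fps_1 L rho .
  also have "(\<lambda>r. central (2 * r) / (2 * real (2 * r) + 1) ^ 2) =
      (\<lambda>r. real ((4 * r) choose (2 * r)) / (16 ^ r * (4 * real r + 1) ^ 2))"
    by (simp add: central)
  also have "(pi / 2 * ln 2 + (L * ln 2 - L ^ 2 / 2 - polylog 2 (\<rho> ^ 2) / 2 + pi ^ 2 / 12)) / 2 =
      pi / 4 * ln 2 + L / 2 * ln 2 - L ^ 2 / 4 + pi ^ 2 / 24 - 1 / 4 * polylog 2 (\<rho> ^ 2)"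
    by (simp add: field_simps)
  finally show "(\<lambda>r. real ((4 * r) choose (2 * r)) / (16 ^ r * (4 * real r + 1) ^ 2)) sums
      (pi / 4 * ln 2 + L / 2 * ln 2 - L ^ 2 / 4 + pi ^ 2 / 24 - 1 / 4 * polylog 2 (\<rho> ^ 2))" .
  let ?S = "4 * pi ^ 2 * ln 2 + 32 / 3 * L ^ 3 - 16 * L ^ 2 * ln 2 + 16 * L * polylog 2 (\<rho> ^ 2)
    + 8 * polylog 3 (\<rho> ^ 2) - 22 * zeta 3"
  have "(\<lambda>r. 1 / (4 * real (2 * r) ^ 3 * central (2 * r))) sums
      ((- (- (pi ^ 2 / 4 * ln 2) + 7 / 8 * zeta 3) + - (L ^ 2 * ln 2 - 2 / 3 * L ^ 3
        - L * polylog 2 (\<rho> ^ 2) - polylog 3 (\<rho> ^ 2) / 2 + zeta 3 / 2)) / 2)"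
    using sums_even_terms[OF eval_arsinh_sq_fps_i_sums eval_arsinh_sq_fps_1_sums]
    unfolding Re_eval_arsinh_sq_fps_i Re_eval_arsinh_sq_fps_1 L rho .
  \<comment> \<open>The factor \<open>32\<close> cancels \<open>4 * 2 ^ 3\<close> in the
    denominator.\<close>
  then have "(\<lambda>r. 32 * (1 / (4 * real (2 * r) ^ 3 * central (2 * r)))) sums
      (32 * ((- (- (pi ^ 2 / 4 * ln 2) + 7 / 8 * zeta 3) + - (L ^ 2 * ln 2 - 2 / 3 * L ^ 3
        - L * polylog 2 (\<rho> ^ 2) - polylog 3 (\<rho> ^ 2) / 2 + zeta 3 / 2)) / 2))"
    by (rule sums_mult)
  also have "(\<lambda>r. 32 * (1 / (4 * real (2 * r) ^ 3 * central (2 * r)))) =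
      (\<lambda>r. 16 ^ r / (real r ^ 3 * real ((4 * r) choose (2 * r))))"
    by (simp add: central fun_eq_iff power_mult_distrib)
  also have "32 * ((- (- (pi ^ 2 / 4 * ln 2) + 7 / 8 * zeta 3) + - (L ^ 2 * ln 2 - 2 / 3 * L ^ 3
        - L * polylog 2 (\<rho> ^ 2) - polylog 3 (\<rho> ^ 2) / 2 + zeta 3 / 2)) / 2) = ?S"
    by (simp add: field_simps)
  \<comment> \<open>The term at \<open>r = 0\<close> is \<open>0\<close> by division by zero, so
    starting the sum at \<open>1\<close> leaves its value unchanged.\<close>
  finally show "(\<lambda>r. 16 ^ Suc r / (real (Suc r) ^ 3 * real ((4 * Suc r) choose (2 * Suc r)))) sums ?S"
    by (subst sums_Suc_iff[of "\<lambda>r. 16 ^ r / (real r ^ 3 * real ((4 * r) choose (2 * r)))"]) simp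
qed

end
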